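(* Let $p,q\in\mathbb{R}$ with $p>0$. The equation $x^3+px+q=0$ has a unique real solution, namely $$\overline r=\left(-\frac q2+\sqrt{\frac{q^2}{4}+\frac{p^3}{27}}\right)^{1/3}+\left(-\frac q2-\sqrt{\frac{q^2}{4}+\frac{p^3}{27}}\right)^{1/3}.$$
   Context: For a real number $t$, $t^{1/3}$ denotes its real cube root (negative if $t<0$). *)

theory Defs
  imports Complex_Main
begin

end

theory Submission
  imports Defs
begin

text \<open>For \<open>p > 0\<close> the cubic is a sum of increasing functions, one of them
  strictly increasing, so it has at most one real zero (\<open>strict_mono_depressed_cubic\<close>).
  Existence needs no continuity argument: Cardano's expression is checked to be a zero
  (\<open>cardano_root\<close>).\<close>

lemma strict_mono_depressed_cubic:
  fixes p q :: real
  assumes "p > 0"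
  shows "strict_mono (\<lambda>x. x ^ 3 + p * x + q)"
proof (rule strict_monoI)
  fix x y :: real
  assume "x < y"
  then have "x ^ 3 \<le> y ^ 3"
    by (intro power_mono_odd) auto
  moreover have "p * x < p * y"
    using \<open>x < y\<close> assms by simp
  ultimately show "x ^ 3 + p * x + q < y ^ 3 + p * y + q"
    by linarith
qed

text \<open>The ansatz x = u + v solves the cubic once u^3 + v^3 = -q and u v = -p/3. Then u^3 and
  v^3 are the zeros of t^2 + q t - p^3/27, which are real when the radicand is nonnegative.\<close>

lemma cardano_root:
  fixes p q :: real
  assumes "q ^ 2 / 4 + p ^ 3 / 27 \<ge> 0"
  defines "r \<equiv> root 3 (- (q / 2) + sqrt (q ^ 2 / 4 + p ^ 3 / 27))
    + root 3 (- (q / 2) - sqrt (q ^ 2 / 4 + p ^ 3 / 27))"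
  shows "r ^ 3 + p * r + q = 0"
proof -
  define s where "s = sqrt (q ^ 2 / 4 + p ^ 3 / 27)"
  define u where "u = root 3 (- (q / 2) + s)"
  define v where "v = root 3 (- (q / 2) - s)"
  have u3: "u ^ 3 = - (q / 2) + s" and v3: "v ^ 3 = - (q / 2) - s"
    unfolding u_def v_def by (simp_all add: odd_real_root_pow)
  have "s ^ 2 = q ^ 2 / 4 + p ^ 3 / 27"
    using assms(1) unfolding s_def by simp
  then have "(- (q / 2) + s) * (- (q / 2) - s) = (- (p / 3)) ^ 3"
    by (simp add: field_simps power2_eq_square power3_eq_cube)
  \<comment> \<open>The real cube root is multiplicative and undoes cubing for either sign, so the
    product of the cubes determines u v.\<close>
  then have uv: "u * v = - (p / 3)"
    unfolding u_def v_def real_root_mult [symmetric]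
    by (metis odd_numeral odd_real_root_power_cancel)
  have "(u + v) ^ 3 = u ^ 3 + v ^ 3 + 3 * (u * v) * (u + v)"
    by algebra
  also have "\<dots> = - q - p * (u + v)"
    unfolding u3 v3 uv by simp
  finally show ?thesis
    unfolding r_def u_def v_def s_def by simp
qed

theorem corollary2:
  fixes p q :: real
  assumes "p > 0"
  shows "(\<exists>!x::real. x ^ 3 + p * x + q = 0) \<and>
    (\<forall>x::real. x ^ 3 + p * x + q = 0 \<longleftrightarrow>
      x = root 3 (- (q / 2) + sqrt (q ^ 2 / 4 + p ^ 3 / 27))
        + root 3 (- (q / 2) - sqrt (q ^ 2 / 4 + p ^ 3 / 27)))"
proof -
  let ?r = "root 3 (- (q / 2) + sqrt (q ^ 2 / 4 + p ^ 3 / 27))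
    + root 3 (- (q / 2) - sqrt (q ^ 2 / 4 + p ^ 3 / 27))"
  have r: "?r ^ 3 + p * ?r + q = 0"
    using assms by (intro cardano_root) simp
  \<comment> \<open>A strictly monotone function is injective, and it takes the value 0 at both
    points.\<close>
  have "x = ?r" if "x ^ 3 + p * x + q = 0" for x
    using strict_mono_eq [OF strict_mono_depressed_cubic [OF assms, of q], of x ?r] that r
    by simp
  with r show ?thesis
    by blast
qed

end
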